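(* Let $M$ be the two-dimensional torus $\mathbb T^2=\mathbb T^1_{x_1}\times\mathbb T^1_{x_2}\simeq[-\frac12,\frac12)^2$ equipped with the Euclidean metric. Let $V\in C^\infty(\mathbb T^2,(0,\infty))$ satisfy $\|V\|_{L^\infty(\mathbb T^2)}=1$, and assume that there is $c\in\mathbb T^1$ such that $\partial_{x_1}V(c,x_2)<0$ for all $x_2\in\mathbb T^1$. Let $\omega:=\{(x_1,x_2)\in\mathbb T^2:\ x_1\ne c\}$. Then for all $T>0$, $(\omega,T)$ satisfies (GCC$_V$) but does not satisfy (GCC).
   Context: For a smooth real function $k$ on $T^*M$ (or on $T^*M$ minus the zero section), $\varphi^k_t$ denotes the flow of its Hamiltonian vector field $H_k=\sum_j \partial_{\xi_j}k\,\partial_{x_j}-\partial_{x_j}k\,\partial_{\xi_j}$ (canonical coordinates); $\pi_M:T^*M\to M$ is the canonical projection, $|\xi|_g$ the norm of a covector, $S^*M=\{(x,\xi)\in T^*M:\ |\xi|_g=1\}$, and $q(x,\xi):=\sqrt{|\xi|_g^2+V(x)}$ on $T^*M$. For an open set $\omega\subset M$ and $T>0$: - $(\omega,T)$ satisfies (GCC) if for every $\rho\in S^*M$ there is $t\in(0,T)$ with $\pi_M\circ\varphi_t^{|\xi|_g}(\rho)\in\omega$; - $(\omega,T)$ satisfies (GCC$_V$) if for every $\rho\in T^*M$ there is $t\in(0,T)$ with $\pi_M\circ\varphi_t^{q}(\rho)\in\omega$. *)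

theory Defs
  imports "HOL-Analysis.Analysis" "HOL-Probability.Essential_Supremum"
begin

quotient_type circle = real / "\<lambda>x y. x - y \<in> \<int>"
proof (rule equivpI)
  show "reflp (\<lambda>x y::real. x - y \<in> \<int>)"
    by (simp add: reflp_def)
  show "symp (\<lambda>x y::real. x - y \<in> \<int>)"
    by (metis (mono_tags, lifting) Ints_minus minus_diff_eq sympI)
  show "transp (\<lambda>x y::real. x - y \<in> \<int>)"
  proof (rule transpI)
    fix x y z :: real
    assume "x - y \<in> \<int>" "y - z \<in> \<int>"
    then have "(x - y) + (y - z) \<in> \<int>" by (rule Ints_add)
    then show "x - z \<in> \<int>" by simp
  qed
qed

instantiation circle :: ab_group_add
begin

lift_definition zero_circle :: circle is 0 .

lift_definition plus_circle :: "circle \<Rightarrow> circle \<Rightarrow> circle" is "(+)"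
  by (metis Ints_add add_diff_add)

lift_definition uminus_circle :: "circle \<Rightarrow> circle" is uminus
  by (metis Ints_minus minus_diff_minus)

definition minus_circle :: "circle \<Rightarrow> circle \<Rightarrow> circle"
  where "minus_circle a b = a + - b"

instance
  by standard (simp add: minus_circle_def | transfer, simp add: algebra_simps)+

end

lift_definition circle_of :: "real \<Rightarrow> circle" is "\<lambda>x. x" .

type_synonym torus = "circle \<times> circle"

text \<open>The cotangent bundle of the torus, trivialised by the canonical coordinates: a point is
  \<open>((x\<^sub>1, x\<^sub>2), (\<xi>\<^sub>1, \<xi>\<^sub>2))\<close>.  On \<open>real \<times> real\<close> the library norm is the Euclidean one, so
  \<open>norm \<xi>\<close> is the norm of the covector \<open>\<xi>\<close> for the Euclidean metric.\<close>

type_synonym cotangent = "torus \<times> (real \<times> real)"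

definition torus_of :: "real \<times> real \<Rightarrow> torus"
  where "torus_of = (\<lambda>(x1, x2). (circle_of x1, circle_of x2))"

primrec Ck_fun :: "nat \<Rightarrow> ('a::euclidean_space \<Rightarrow> real) \<Rightarrow> bool"
  where
    "Ck_fun 0 f \<longleftrightarrow> continuous_on UNIV f"
  | "Ck_fun (Suc k) f \<longleftrightarrow>
       (\<forall>x. f differentiable (at x)) \<and>
       (\<forall>e\<in>Basis. Ck_fun k (\<lambda>x. frechet_derivative f (at x) e))"

definition smooth_on_torus :: "(torus \<Rightarrow> real) \<Rightarrow> bool"
  where "smooth_on_torus f \<longleftrightarrow> (\<forall>k. Ck_fun k (\<lambda>x. f (torus_of x)))"

text \<open>The torus carries Lebesgue measure on its fundamental domain.\<close>

definition Linf_norm :: "(torus \<Rightarrow> real) \<Rightarrow> ereal"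
  where "Linf_norm f =
    esssup (restrict_space lborel ({-1/2..<1/2} \<times> {-1/2..<1/2}))
      (\<lambda>x. ereal \<bar>f (torus_of x)\<bar>)"

text \<open>The derivative of \<open>f\<close> in the direction of the constant vector field \<open>v\<close>, whose flow is
  the translation by \<open>torus_of (s *\<^sub>R v)\<close>.\<close>

definition torus_deriv :: "real \<times> real \<Rightarrow> (torus \<Rightarrow> real) \<Rightarrow> torus \<Rightarrow> real"
  where "torus_deriv v f x = deriv (\<lambda>s. f (x + torus_of (s *\<^sub>R v))) 0"

abbreviation partial_x1 :: "(torus \<Rightarrow> real) \<Rightarrow> torus \<Rightarrow> real"
  where "partial_x1 \<equiv> torus_deriv (1, 0)"

abbreviation partial_x2 :: "(torus \<Rightarrow> real) \<Rightarrow> torus \<Rightarrow> real"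
  where "partial_x2 \<equiv> torus_deriv (0, 1)"

definition hamiltonian_vf :: "(cotangent \<Rightarrow> real) \<Rightarrow> cotangent \<Rightarrow> (real \<times> real) \<times> (real \<times> real)"
  where "hamiltonian_vf k = (\<lambda>(x, (\<xi>1, \<xi>2)).
    ((deriv (\<lambda>s. k (x, (s, \<xi>2))) \<xi>1, deriv (\<lambda>s. k (x, (\<xi>1, s))) \<xi>2),
     (- partial_x1 (\<lambda>y. k (y, (\<xi>1, \<xi>2))) x, - partial_x2 (\<lambda>y. k (y, (\<xi>1, \<xi>2))) x)))"

text \<open>Integral curves of the Hamiltonian vector field of \<open>k\<close> that stay in the domain \<open>U\<close> of \<open>k\<close>.
  The base component of a curve in \<open>cotangent\<close> is differentiated through a lift \<open>X\<close> to the
  universal cover \<open>real \<times> real\<close>; every continuous curve on an interval has one, and the velocity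
  does not depend on its choice.\<close>

definition integral_curve ::
  "cotangent set \<Rightarrow> (cotangent \<Rightarrow> real) \<Rightarrow> real set \<Rightarrow> (real \<Rightarrow> cotangent) \<Rightarrow> bool"
  where "integral_curve U k I \<gamma> \<longleftrightarrow>
    (\<exists>X \<Xi>. \<forall>t\<in>I. \<gamma> t \<in> U \<and> \<gamma> t = (torus_of (X t), \<Xi> t) \<and>
       ((\<lambda>s. (X s, \<Xi> s)) has_vector_derivative hamiltonian_vf k (\<gamma> t)) (at t))"

text \<open>\<open>hamiltonian_flow U k t \<rho>\<close> is the point reached at time \<open>t\<close> by the integral curve that
  starts at \<open>\<rho>\<close> at time \<open>0\<close>.  For smooth \<open>k\<close> this point is unique; it is unspecified if the
  maximal integral curve does not reach time \<open>t\<close>.  The latter does not happen for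
  the two Hamiltonians used below, whose flows are complete.\<close>

definition hamiltonian_flow ::
  "cotangent set \<Rightarrow> (cotangent \<Rightarrow> real) \<Rightarrow> real \<Rightarrow> cotangent \<Rightarrow> cotangent"
  where "hamiltonian_flow U k t \<rho> =
    (THE \<rho>'. \<exists>I \<gamma>. open I \<and> is_interval I \<and> 0 \<in> I \<and> t \<in> I \<and>
       integral_curve U k I \<gamma> \<and> \<gamma> 0 = \<rho> \<and> \<gamma> t = \<rho>')"

definition cosphere :: "cotangent set"
  where "cosphere = {(x, \<xi>). norm \<xi> = 1}"

definition punctured_cotangent :: "cotangent set"
  where "punctured_cotangent = {(x, \<xi>). \<xi> \<noteq> 0}"

definition covector_norm :: "cotangent \<Rightarrow> real"
  where "covector_norm = (\<lambda>(x, \<xi>). norm \<xi>)"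

definition q_symbol :: "(torus \<Rightarrow> real) \<Rightarrow> cotangent \<Rightarrow> real"
  where "q_symbol V = (\<lambda>(x, \<xi>). sqrt ((norm \<xi>)\<^sup>2 + V x))"

text \<open>The bundle projection is \<open>fst\<close>.\<close>

definition GCC :: "torus set \<Rightarrow> real \<Rightarrow> bool"
  where "GCC \<omega> T \<longleftrightarrow>
    (\<forall>\<rho>\<in>cosphere. \<exists>t\<in>{0<..<T}.
       fst (hamiltonian_flow punctured_cotangent covector_norm t \<rho>) \<in> \<omega>)"

definition GCC_V :: "(torus \<Rightarrow> real) \<Rightarrow> torus set \<Rightarrow> real \<Rightarrow> bool"
  where "GCC_V V \<omega> T \<longleftrightarrow>
    (\<forall>\<rho>. \<exists>t\<in>{0<..<T}. fst (hamiltonian_flow UNIV (q_symbol V) t \<rho>) \<in> \<omega>)"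

end

theory Submission
  imports Defs
begin

text \<open>A trajectory of \<open>q\<close> can avoid \<open>\<omega>\<close> on a time interval only if \<open>x\<^sub>1 = c\<close> there.  Then
  \<open>\<xi>\<^sub>1 = q x\<^sub>1' = 0\<close> on this interval, which contradicts \<open>\<xi>\<^sub>1' = - \<partial>\<^sub>1V / (2 q) > 0\<close>.  The
  geodesic through \<open>(c, 0)\<close> in direction \<open>(0, 1)\<close>, on the other hand, stays in \<open>x\<^sub>1 = c\<close>.  As
  \<open>hamiltonian_flow\<close> is a definite description, both arguments need existence and uniqueness of
  integral curves, but only for small times in the case of \<open>q\<close>.  Its Hamiltonian vector field
  lifts to a globally Lipschitz field on the universal cover, because \<open>V\<close> and its first partial
  derivatives are periodic and \<open>C\<^sup>1\<close>, and \<open>q\<close> is bounded away from \<open>0\<close>.\<close>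

section \<open>Ordinary differential equations with Lipschitz right-hand side\<close>

text \<open>Picard iteration: for small \<open>e\<close> the integral operator is a contraction of
  the complete space of bounded continuous functions on the line, and its fixed point solves the
  equation near \<open>0\<close>.\<close>

lemma lipschitz_ode_local_solution:
  fixes F :: "'a::banach \<Rightarrow> 'a"
  assumes F: "L-lipschitz_on UNIV F"
  obtains Z e where "e > 0" "Z 0 = z0"
    "\<And>t. t \<in> {-e<..<e} \<Longrightarrow> (Z has_vector_derivative F (Z t)) (at t)"
proof -
  have L: "L \<ge> 0" using F by (rule lipschitz_on_nonneg)
  \<comment> \<open>Two iterates differ by two integrals, each over an interval of length at most
    \<open>2 * e\<close>, so the contraction factor is \<open>4 * (e * L)\<close>. The summand
    \<open>8\<close> keeps \<open>e\<close> finite and positive when \<open>L = 0\<close>.\<close>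
  define e where "e = 1 / (8 * L + 8)"
  have e: "e > 0" and eL: "4 * (e * L) \<le> 1/2"
    using L by (auto simp: e_def field_simps)
  \<comment> \<open>\<open>integral {0..t}\<close> vanishes for \<open>t < 0\<close>, hence the difference of integrals from \<open>-e\<close>.\<close>
  define G where "G \<phi> t = z0 + integral {-e..t} (\<lambda>s. F (\<phi> s)) - integral {-e..0} (\<lambda>s. F (\<phi> s))"
    for \<phi> and t :: real
  \<comment> \<open>The functions in the Banach space live on the whole line. \<open>clamp\<close>
    continues \<open>G\<close> by its endpoint values beyond \<open>{-e..e}\<close>, which keeps the
    image continuous and bounded.\<close>
  define P where "P \<phi> = Bcontfun (\<lambda>t. G (apply_bcontfun \<phi>) (clamp (-e) e t))" for \<phi>
  have cF: "continuous_on S (\<lambda>s. F (apply_bcontfun \<phi> s))" for \<phi> :: "real \<Rightarrow>\<^sub>C 'a" and S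
    by (rule continuous_on_compose2[OF lipschitz_on_continuous_on[OF F]])
      (auto intro: continuous_intros)
  have cG: "continuous_on (cbox (-e) e) (G (apply_bcontfun \<phi>))" for \<phi>
    unfolding G_def
    by (auto intro!: continuous_intros indefinite_integral_continuous_1 integrable_continuous_real cF)
  have P: "apply_bcontfun (P \<phi>) = (\<lambda>t. G (apply_bcontfun \<phi>) (clamp (-e) e t))" for \<phi>
    unfolding P_def
  proof (rule Bcontfun_inverse)
    show "(\<lambda>t. G (apply_bcontfun \<phi>) (clamp (-e) e t)) \<in> bcontfun"
      unfolding bcontfun_def
      using clamp_continuous_on[OF cG] clamp_bounded[OF compact_imp_bounded[OF compact_continuous_image[OF cG compact_cbox]]]
      by auto
  qed
  have *: "norm (integral {-e..t} (\<lambda>s. F (apply_bcontfun \<phi> s)) - integral {-e..t} (\<lambda>s. F (apply_bcontfun \<psi> s)))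
      \<le> 2 * (e * L) * dist \<phi> \<psi>"
    if t: "t \<in> {-e..e}" for \<phi> \<psi> t
  proof -
    have "norm (integral {-e..t} (\<lambda>s. F (apply_bcontfun \<phi> s)) - integral {-e..t} (\<lambda>s. F (apply_bcontfun \<psi> s)))
       = norm (integral {-e..t} (\<lambda>s. F (apply_bcontfun \<phi> s) - F (apply_bcontfun \<psi> s)))"
      by (subst integral_diff) (auto intro!: integrable_continuous_real cF)
    also have "\<dots> \<le> L * dist \<phi> \<psi> * (t - (-e))"
    proof (rule integral_bound)
      show "norm (F (apply_bcontfun \<phi> s) - F (apply_bcontfun \<psi> s)) \<le> L * dist \<phi> \<psi>" for s
        unfolding dist_norm[symmetric]
        using lipschitz_onD[OF F, of "apply_bcontfun \<phi> s" "apply_bcontfun \<psi> s"]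
          mult_left_mono[OF dist_bounded[of \<phi> s \<psi>] L] by simp
    qed (use t in \<open>auto intro!: continuous_intros cF\<close>)
    also have "\<dots> \<le> L * dist \<phi> \<psi> * (2 * e)"
      using t L by (intro mult_left_mono) auto
    finally show ?thesis by (simp add: algebra_simps)
  qed
  have "\<exists>!\<phi>. P \<phi> = \<phi>"
  proof (rule banach_fix_type[of "1/2"], safe)
    fix \<phi> \<psi>
    show "dist (P \<phi>) (P \<psi>) \<le> 1/2 * dist \<phi> \<psi>"
    proof (rule dist_bound)
      fix t
      define s where "s = clamp (-e) e t"
      have s: "s \<in> {-e..e}"
        using clamp_in_interval[of "-e" e t] e by (simp add: s_def)
      have "dist (P \<phi> t) (P \<psi> t) = norm
          ((integral {-e..s} (\<lambda>s. F (apply_bcontfun \<phi> s)) - integral {-e..s} (\<lambda>s. F (apply_bcontfun \<psi> s)))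
          - (integral {-e..0} (\<lambda>s. F (apply_bcontfun \<phi> s)) - integral {-e..0} (\<lambda>s. F (apply_bcontfun \<psi> s))))"
        by (simp add: P s_def[symmetric] G_def dist_norm algebra_simps)
      also have "\<dots> \<le> 2 * (e * L) * dist \<phi> \<psi> + 2 * (e * L) * dist \<phi> \<psi>"
        using norm_triangle_le_diff[OF add_mono[OF *[OF s, of \<phi> \<psi>] *[of 0 \<phi> \<psi>]]] e by auto
      also have "\<dots> = 4 * (e * L) * dist \<phi> \<psi>"
        by simp
      also have "\<dots> \<le> 1/2 * dist \<phi> \<psi>"
        by (rule mult_right_mono[OF eL]) auto
      finally show "dist (P \<phi> t) (P \<psi> t) \<le> 1/2 * dist \<phi> \<psi>" .
    qed
  qed auto
  then obtain \<phi> where \<phi>: "P \<phi> = \<phi>" by blast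
  have \<phi>G: "apply_bcontfun \<phi> t = G (apply_bcontfun \<phi>) t" if "t \<in> {-e..e}" for t
    using that fun_cong[OF P[of \<phi>], of t] by (simp add: \<phi>)
  show thesis
  proof (rule that[of e "apply_bcontfun \<phi>"])
    show "apply_bcontfun \<phi> 0 = z0"
      using \<phi>G[of 0] e by (simp add: G_def)
    fix t assume t: "t \<in> {-e<..<e}"
    have "((\<lambda>u. integral {-e..u} (\<lambda>s. F (apply_bcontfun \<phi> s))) has_vector_derivative F (apply_bcontfun \<phi> t))
        (at t within {-e..e})"
      using t by (intro integral_has_vector_derivative cF) auto
    then have "((\<lambda>u. integral {-e..u} (\<lambda>s. F (apply_bcontfun \<phi> s))) has_vector_derivative F (apply_bcontfun \<phi> t)) (at t)"
      using t at_within_interior[of t "{-e..e}"] by simp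
    then have "(G (apply_bcontfun \<phi>) has_vector_derivative F (apply_bcontfun \<phi> t)) (at t)"
      unfolding G_def by (auto intro!: derivative_eq_intros)
    moreover have "\<forall>s\<in>{-e<..<e}. G (apply_bcontfun \<phi>) s = apply_bcontfun \<phi> s"
      using \<phi>G by auto
    ultimately show "(apply_bcontfun \<phi> has_vector_derivative F (apply_bcontfun \<phi> t)) (at t)"
      using has_vector_derivative_transform_within_open[of "G (apply_bcontfun \<phi>)" _ t "{-e<..<e}"] t
      by auto
  qed (rule e)
qed

text \<open>Gronwall's argument for the squared distance, which is differentiable even where the two
  solutions meet.\<close>

lemma lipschitz_ode_unique:
  fixes F :: "'a::real_inner \<Rightarrow> 'a"
  assumes F: "L-lipschitz_on UNIV F"
    and Y: "\<And>s. s \<in> {0..t} \<Longrightarrow> (Y has_vector_derivative F (Y s)) (at s)"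
    and Z: "\<And>s. s \<in> {0..t} \<Longrightarrow> (Z has_vector_derivative F (Z s)) (at s)"
    and eq: "Y 0 = Z 0" and t: "0 \<le> t"
  shows "Y t = Z t"
proof -
  define D where "D s = Y s - Z s" for s
  \<comment> \<open>The exponential rate absorbs the growth of \<open>D s \<bullet> D s\<close>,
    whose derivative is at most \<open>2 * L\<close> times its value by Cauchy-Schwarz.\<close>
  define u where "u s = exp (- 2 * L * s) * (D s \<bullet> D s)" for s
  have "u t \<le> u 0"
  proof (rule DERIV_nonpos_imp_nonincreasing[OF t])
    fix s assume "0 \<le> s" "s \<le> t"
    then have s: "s \<in> {0..t}" by simp
    define w where "w = F (Y s) - F (Z s)"
    have "(D has_vector_derivative w) (at s)"
      unfolding D_def w_def by (intro derivative_intros Y Z s)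
    then have "((\<lambda>s. D s \<bullet> D s) has_real_derivative 2 * (D s \<bullet> w)) (at s)"
      unfolding has_vector_derivative_def has_field_derivative_def
      by (auto intro!: derivative_eq_intros simp: inner_commute algebra_simps)
    then have "(u has_real_derivative exp (- 2 * L * s) * (2 * (D s \<bullet> w) - 2 * L * (D s \<bullet> D s))) (at s)"
      unfolding u_def by (auto intro!: derivative_eq_intros simp: algebra_simps)
    moreover have "D s \<bullet> w \<le> L * (D s \<bullet> D s)"
    proof -
      have "D s \<bullet> w \<le> norm (D s) * norm w" by (rule norm_cauchy_schwarz)
      also have "\<dots> \<le> norm (D s) * (L * norm (D s))"
        unfolding w_def D_def by (intro mult_left_mono lipschitz_on_normD[OF F]) auto
      finally show ?thesis by (simp add: dot_square_norm power2_eq_square algebra_simps)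
    qed
    ultimately show "\<exists>y. (u has_real_derivative y) (at s) \<and> y \<le> 0"
      by (intro exI conjI) (auto simp: mult_le_0_iff)
  qed
  then have "D t \<bullet> D t \<le> 0"
    by (simp add: u_def D_def eq mult_le_0_iff)
  then have "D t = 0"
    using inner_ge_zero[of "D t"] by (metis antisym inner_eq_zero_iff)
  then show ?thesis by (simp add: D_def)
qed

section \<open>The universal cover of the torus and the flow computed on it\<close>

lemma torus_of_eq_iff: "torus_of x = torus_of y \<longleftrightarrow> fst x - fst y \<in> \<int> \<and> snd x - snd y \<in> \<int>"
  unfolding torus_of_def by (simp add: split_beta) (transfer, simp)

lemma torus_of_add: "torus_of (x + y) = torus_of x + torus_of y"
  unfolding torus_of_def by (simp add: split_beta) (transfer, simp)

lemma surj_torus_of: "\<exists>p. torus_of p = x"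
proof -
  have "\<exists>r. circle_of r = a" for a by transfer (metis Ints_0 diff_self)
  then show ?thesis unfolding torus_of_def by (cases x) auto
qed

text \<open>Turns the definite description into a uniqueness question on the universal cover.
  Competitors need to be compared only if they start at the same lift \<open>Z 0\<close>, because
  the field depends on the base point through \<open>torus_of\<close> alone and is thus invariant
  under integer translations.\<close>

lemma hamiltonian_flow_eqI:
  assumes I: "open I" "is_interval I" "0 \<in> I" "t \<in> I"
    and Z: "\<And>s. s \<in> I \<Longrightarrow> (torus_of (fst (Z s)), snd (Z s)) \<in> U \<and>
      (Z has_vector_derivative hamiltonian_vf k (torus_of (fst (Z s)), snd (Z s))) (at s)"
    and unique: "\<And>J Y. open J \<Longrightarrow> is_interval J \<Longrightarrow> 0 \<in> J \<Longrightarrow> t \<in> J \<Longrightarrow> Y 0 = Z 0 \<Longrightarrow>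
      (\<And>s. s \<in> J \<Longrightarrow> (torus_of (fst (Y s)), snd (Y s)) \<in> U \<and>
        (Y has_vector_derivative hamiltonian_vf k (torus_of (fst (Y s)), snd (Y s))) (at s)) \<Longrightarrow>
      Y t = Z t"
  shows "hamiltonian_flow U k t (torus_of (fst (Z 0)), snd (Z 0)) = (torus_of (fst (Z t)), snd (Z t))"
  unfolding hamiltonian_flow_def
proof (rule the_equality)
  let ?\<gamma> = "\<lambda>s. (torus_of (fst (Z s)), snd (Z s))"
  have "integral_curve U k I ?\<gamma>"
    unfolding integral_curve_def using Z
    by (intro exI[of _ "\<lambda>s. fst (Z s)"] exI[of _ "\<lambda>s. snd (Z s)"]) auto
  then show "\<exists>I \<gamma>. open I \<and> is_interval I \<and> 0 \<in> I \<and> t \<in> I \<and> integral_curve U k I \<gamma> \<and>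
      \<gamma> 0 = (torus_of (fst (Z 0)), snd (Z 0)) \<and> \<gamma> t = (torus_of (fst (Z t)), snd (Z t))"
    using I by (intro exI[of _ I] exI[of _ ?\<gamma>]) auto
  fix \<rho>
  assume "\<exists>I \<gamma>. open I \<and> is_interval I \<and> 0 \<in> I \<and> t \<in> I \<and> integral_curve U k I \<gamma> \<and>
      \<gamma> 0 = (torus_of (fst (Z 0)), snd (Z 0)) \<and> \<gamma> t = \<rho>"
  then obtain J \<gamma> X \<Xi> where J: "open J" "is_interval J" "0 \<in> J" "t \<in> J"
    and \<gamma>0: "\<gamma> 0 = (torus_of (fst (Z 0)), snd (Z 0))" and \<gamma>t: "\<gamma> t = \<rho>"
    and c: "\<And>s. s \<in> J \<Longrightarrow> \<gamma> s \<in> U \<and> \<gamma> s = (torus_of (X s), \<Xi> s) \<and>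
       ((\<lambda>s. (X s, \<Xi> s)) has_vector_derivative hamiltonian_vf k (\<gamma> s)) (at s)"
    unfolding integral_curve_def by blast
  \<comment> \<open>The lift of the second curve is only determined up to an integer translation.\<close>
  define v where "v = fst (Z 0) - X 0"
  define Y where "Y s = (X s + v, \<Xi> s)" for s
  have eq0: "torus_of (X 0) = torus_of (fst (Z 0))" "\<Xi> 0 = snd (Z 0)"
    using c[OF J(3)] \<gamma>0 by auto
  have v: "torus_of (x + v) = torus_of x" for x
    using eq0(1)[symmetric] by (simp add: torus_of_eq_iff v_def)
  have \<gamma>Y: "(torus_of (fst (Y s)), snd (Y s)) = \<gamma> s" if "s \<in> J" for s
    using c[OF that] by (simp add: Y_def v)
  have "Y t = Z t"
  proof (rule unique[OF J])
    show "Y 0 = Z 0" by (simp add: Y_def v_def eq0)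
    fix s assume s: "s \<in> J"
    have "((\<lambda>s. (X s, \<Xi> s) + (v, 0)) has_vector_derivative hamiltonian_vf k (\<gamma> s)) (at s)"
      unfolding has_vector_derivative_add_const using c[OF s] by blast
    moreover have "(\<lambda>s. (X s, \<Xi> s) + (v, 0)) = Y" by (simp add: Y_def fun_eq_iff)
    ultimately show "(torus_of (fst (Y s)), snd (Y s)) \<in> U \<and>
        (Y has_vector_derivative hamiltonian_vf k (torus_of (fst (Y s)), snd (Y s))) (at s)"
      unfolding \<gamma>Y[OF s] using c[OF s] by metis
  qed
  then show "\<rho> = (torus_of (fst (Z t)), snd (Z t))"
    using \<gamma>Y[OF J(4)] \<gamma>t by simp
qed

section \<open>Periodic functions and Lipschitz bounds\<close>

text \<open>Taking fractional parts shows that all values already occur on the closed unit square,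
  which is compact.\<close>

lemma compact_range_periodic:
  fixes f :: "real \<times> real \<Rightarrow> 'a::topological_space"
  assumes cont: "continuous_on UNIV f"
    and per: "\<And>x y. torus_of x = torus_of y \<Longrightarrow> f x = f y"
  shows "compact (range f)"
proof -
  have "f x \<in> f ` cbox (0, 0) (1, 1)" for x
  proof (rule image_eqI)
    show "f x = f (frac (fst x), frac (snd x))"
      by (rule per) (simp add: torus_of_eq_iff frac_def)
    show "(frac (fst x), frac (snd x)) \<in> cbox (0, 0) (1, 1)"
      by (simp add: cbox_Pair_iff less_imp_le frac_lt_1)
  qed
  then have "range f = f ` cbox (0, 0) (1, 1)" by auto
  then show ?thesis
    using compact_continuous_image[OF continuous_on_subset[OF cont] compact_cbox] by auto
qed

text \<open>\<open>frechet_derivative\<close> is a choice among the derivatives at a point. The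
  predicates chosen from at \<open>x\<close> and at \<open>y\<close> coincide, hence so do the
  choices.\<close>

lemma frechet_derivative_periodic:
  fixes f :: "real \<times> real \<Rightarrow> real"
  assumes per: "\<And>x y. torus_of x = torus_of y \<Longrightarrow> f x = f y"
    and xy: "torus_of x = torus_of y"
  shows "frechet_derivative f (at x) = frechet_derivative f (at y)"
proof -
  have "f (x + h) = f (y + h)" for h
    by (rule per) (simp add: torus_of_add xy)
  then show ?thesis
    using per[OF xy] unfolding frechet_derivative_def has_derivative_at by simp
qed

lemma Ck_fun_Suc_differentiable: "Ck_fun (Suc k) f \<Longrightarrow> f differentiable (at x)"
  by (simp del: split_paired_All)

lemma Ck_fun_Suc_continuous: "Ck_fun (Suc k) f \<Longrightarrow> continuous_on UNIV f"
  by (intro continuous_at_imp_continuous_on ballI differentiable_imp_continuous_within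
      Ck_fun_Suc_differentiable)

text \<open>The partial derivatives are continuous and periodic, hence bounded; a bounded derivative
  on a convex set gives a Lipschitz constant.\<close>

lemma periodic_C1_lipschitz:
  fixes f :: "real \<times> real \<Rightarrow> real"
  assumes C1: "Ck_fun (Suc 0) f"
    and per: "\<And>x y. torus_of x = torus_of y \<Longrightarrow> f x = f y"
  obtains L where "L-lipschitz_on UNIV f"
proof -
  define D where "D e x = frechet_derivative f (at x) e" for e x
  have "compact (range (D e))" if "e \<in> Basis" for e
  proof (rule compact_range_periodic)
    show "continuous_on UNIV (D e)"
      using C1 that by (simp add: D_def)
    show "D e x = D e y" if "torus_of x = torus_of y" for x y
      unfolding D_def by (subst frechet_derivative_periodic[of f, OF per that]) auto
  qed
  then have "bounded (range (D (1, 0)))" "bounded (range (D (0, 1)))"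
    by (auto intro!: compact_imp_bounded simp: Basis_prod_def)
  then obtain B C where B: "\<And>x. \<bar>D (1, 0) x\<bar> \<le> B" and C: "\<And>x. \<bar>D (0, 1) x\<bar> \<le> C"
    unfolding bounded_iff by auto
  have "(B + C)-lipschitz_on UNIV f"
  proof (rule bounded_derivative_imp_lipschitz)
    fix x
    have diff: "f differentiable (at x)" using C1 by (rule Ck_fun_Suc_differentiable)
    then show "(f has_derivative frechet_derivative f (at x)) (at x within UNIV)"
      by (simp add: frechet_derivative_works[symmetric])
    have lin: "linear (frechet_derivative f (at x))"
      by (rule linear_frechet_derivative[OF diff])
    show "onorm (frechet_derivative f (at x)) \<le> B + C"
    proof (rule onorm_le)
      fix h :: "real \<times> real"
      have "frechet_derivative f (at x) h
          = frechet_derivative f (at x) (fst h *\<^sub>R (1, 0) + snd h *\<^sub>R (0, 1))" by simp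
      also have "\<dots> = fst h * D (1, 0) x + snd h * D (0, 1) x"
        by (simp only: D_def linear_add[OF lin] linear_scale[OF lin] real_scaleR_def)
      also have "\<bar>\<dots>\<bar> \<le> \<bar>fst h\<bar> * \<bar>D (1, 0) x\<bar> + \<bar>snd h\<bar> * \<bar>D (0, 1) x\<bar>"
        by (metis abs_triangle_ineq abs_mult)
      also have "\<dots> \<le> norm h * B + norm h * C"
        using norm_fst_le[of "fst h" "snd h"] norm_snd_le[of "snd h" "fst h"]
        by (intro add_mono mult_mono B C) auto
      finally show "norm (frechet_derivative f (at x) h) \<le> (B + C) * norm h"
        by (simp add: algebra_simps)
    qed
  qed (use B[of 0] C[of 0] in auto)
  then show thesis by (rule that)
qed

text \<open>A quotient rule for Lipschitz functions whose numerator may be unbounded, as long as it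
  is dominated by the denominator. This is the situation of the field of \<open>q\<close>, whose
  numerator contains the covector.\<close>

lemma lipschitz_on_inverse_scaleR:
  fixes a :: "'a::metric_space \<Rightarrow> 'b::real_normed_vector" and q :: "'a \<Rightarrow> real"
  assumes a: "L-lipschitz_on S a" and q: "M-lipschitz_on S q"
    and \<delta>: "\<delta> > 0" "\<And>x. x \<in> S \<Longrightarrow> \<delta> \<le> q x"
    and C: "C \<ge> 0" "\<And>x. x \<in> S \<Longrightarrow> norm (a x) \<le> C * q x"
  shows "((L + C * M) / \<delta>)-lipschitz_on S (\<lambda>x. inverse (q x) *\<^sub>R a x)"
proof (rule lipschitz_onI)
  have L: "0 \<le> L" and M: "0 \<le> M"
    using a q by (auto intro: lipschitz_on_nonneg)
  show "0 \<le> (L + C * M) / \<delta>" using L M C(1) \<delta>(1) by simp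
  fix x y assume x: "x \<in> S" and y: "y \<in> S"
  have qx: "q x > 0" "q y > 0" using \<delta>(1) \<delta>(2)[OF x] \<delta>(2)[OF y] by linarith+
  \<comment> \<open>After multiplication by \<open>q y\<close>, the only remaining quotient is
    \<open>a x / q x\<close>, whose norm is at most \<open>C\<close>.\<close>
  have "q y *\<^sub>R (inverse (q x) *\<^sub>R a x - inverse (q y) *\<^sub>R a y)
     = (a x - a y) + ((q y - q x) / q x) *\<^sub>R a x"
  proof -
    have "(q y - q x) / q x = q y * inverse (q x) - 1"
      using qx by (simp add: field_simps)
    then show ?thesis
      using qx by (simp add: scaleR_diff_right scaleR_diff_left)
  qed
  then have "q y * norm (inverse (q x) *\<^sub>R a x - inverse (q y) *\<^sub>R a y)
      = norm ((a x - a y) + ((q y - q x) / q x) *\<^sub>R a x)"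
    using qx by (metis abs_of_pos norm_scaleR)
  also have "\<dots> \<le> norm (a x - a y) + \<bar>q y - q x\<bar> * (norm (a x) / q x)"
    using norm_triangle_ineq[of "a x - a y" "((q y - q x) / q x) *\<^sub>R a x"] qx by simp
  also have "\<dots> \<le> L * dist x y + M * dist x y * C"
  proof (intro add_mono mult_mono)
    show "norm (a x - a y) \<le> L * dist x y"
      using lipschitz_onD[OF a x y] by (simp add: dist_norm)
    show "\<bar>q y - q x\<bar> \<le> M * dist x y"
      using lipschitz_onD[OF q y x] by (simp add: dist_real_def dist_commute)
    show "norm (a x) / q x \<le> C"
      using C(2)[OF x] qx by (simp add: field_simps)
  qed (use M qx in auto)
  finally have "q y * norm (inverse (q x) *\<^sub>R a x - inverse (q y) *\<^sub>R a y) \<le> (L + C * M) * dist x y"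
    by (simp add: algebra_simps)
  moreover have "\<delta> * norm (inverse (q x) *\<^sub>R a x - inverse (q y) *\<^sub>R a y)
      \<le> q y * norm (inverse (q x) *\<^sub>R a x - inverse (q y) *\<^sub>R a y)"
    by (intro mult_right_mono \<delta> y) auto
  ultimately show "dist (inverse (q x) *\<^sub>R a x) (inverse (q y) *\<^sub>R a y) \<le> (L + C * M) / \<delta> * dist x y"
    using \<delta>(1) by (simp add: dist_norm field_simps)
qed

lemma lipschitz_on_sqrt:
  "m > 0 \<Longrightarrow> (1 / sqrt m)-lipschitz_on {m..} sqrt"
proof (rule lipschitz_onI)
  fix x y assume m: "m > 0" and "x \<in> {m..}" "y \<in> {m..}"
  then have xy: "m \<le> x" "m \<le> y" by auto
  have "sqrt m \<le> sqrt x + sqrt y" using xy m by (simp add: add_increasing2)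
  then have "sqrt m * \<bar>sqrt x - sqrt y\<bar> \<le> (sqrt x + sqrt y) * \<bar>sqrt x - sqrt y\<bar>"
    by (rule mult_right_mono) simp
  also have "\<dots> = \<bar>(sqrt x + sqrt y) * (sqrt x - sqrt y)\<bar>"
    using xy m by (simp add: abs_mult)
  also have "(sqrt x + sqrt y) * (sqrt x - sqrt y) = x - y"
    using xy m by (simp add: algebra_simps)
  finally show "dist (sqrt x) (sqrt y) \<le> 1 / sqrt m * dist x y"
    using m by (simp add: dist_real_def field_simps)
qed simp

section \<open>The Hamiltonian vector field of \<open>q\<close> and its flow for small times\<close>

text \<open>\<open>torus_of\<close> is a homomorphism, so translation on the torus lifts to
  translation on the plane and the chain rule applies there.\<close>

lemma torus_deriv_eq:
  assumes "((\<lambda>p. f (torus_of p)) has_derivative D) (at p)"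
  shows "torus_deriv v f (torus_of p) = D v"
proof -
  have "((\<lambda>s. f (torus_of (p + s *\<^sub>R v))) has_derivative (\<lambda>s. D (s *\<^sub>R v))) (at 0)"
    by (rule has_derivative_compose[where g = "\<lambda>p. f (torus_of p)" and f = "\<lambda>s. p + s *\<^sub>R v"])
      (use assms in \<open>auto intro!: derivative_eq_intros\<close>)
  moreover have "(\<lambda>s. D (s *\<^sub>R v)) = (*) (D v)"
    using linear_scale[OF has_derivative_linear[OF assms]] by (auto simp: mult.commute)
  ultimately show ?thesis
    unfolding torus_deriv_def
    by (intro DERIV_imp_deriv) (simp add: has_field_derivative_def torus_of_add)
qed

text \<open>Chain rule for the square root. Positivity of \<open>V\<close> keeps its argument away
  from \<open>0\<close>, also on the zero section.\<close>

lemma hamiltonian_vf_q_symbol: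
  assumes pos: "\<And>x. V x > 0"
    and diff: "(\<lambda>p. V (torus_of p)) differentiable (at p)"
  shows "hamiltonian_vf (q_symbol V) (torus_of p, \<xi>) =
    inverse (q_symbol V (torus_of p, \<xi>)) *\<^sub>R
      (\<xi>, (-1/2) *\<^sub>R (partial_x1 V (torus_of p), partial_x2 V (torus_of p)))"
proof -
  define Q where "Q = q_symbol V (torus_of p, \<xi>)"
  obtain D where D: "((\<lambda>p. V (torus_of p)) has_derivative D) (at p)"
    using diff unfolding differentiable_def by blast
  have arg: "(norm \<zeta>)\<^sup>2 + V x > 0" for \<zeta> :: "real \<times> real" and x
    by (intro add_nonneg_pos pos) simp
  have "((\<lambda>p. q_symbol V (torus_of p, \<xi>)) has_derivative (\<lambda>h. D h / (2 * Q))) (at p)"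
    unfolding q_symbol_def Q_def
    using arg[of \<xi> "torus_of p"] by (auto intro!: derivative_eq_intros D simp: field_simps)
  from torus_deriv_eq[OF this] torus_deriv_eq[OF D]
  have x: "torus_deriv v (\<lambda>y. q_symbol V (y, \<xi>)) (torus_of p)
      = torus_deriv v V (torus_of p) / (2 * Q)" for v by simp
  obtain \<xi>1 \<xi>2 where \<xi>: "\<xi> = (\<xi>1, \<xi>2)" by (cases \<xi>)
  have norm2: "(norm (a, b))\<^sup>2 = a\<^sup>2 + b\<^sup>2" for a b :: real
    by (simp add: norm_Pair)
  have "((\<lambda>s. q_symbol V (torus_of p, (s, \<xi>2))) has_real_derivative \<xi>1 / Q) (at \<xi>1)"
    "((\<lambda>s. q_symbol V (torus_of p, (\<xi>1, s))) has_real_derivative \<xi>2 / Q) (at \<xi>2)"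
    using arg[of \<xi> "torus_of p"]
    unfolding q_symbol_def Q_def \<xi>
    by (auto intro!: derivative_eq_intros simp: norm2 field_simps)
  then show ?thesis
    using x unfolding hamiltonian_vf_def Q_def[symmetric]
    by (simp add: \<xi> DERIV_imp_deriv field_simps)
qed

text \<open>The field is the quotient of \<open>(\<xi>, -1/2 grad V)\<close> by \<open>q\<close>.
  The numerator is Lipschitz since the second derivatives of \<open>V\<close> are bounded, and
  \<open>q\<close> is at least the square root of the minimum of \<open>V\<close>.\<close>

lemma lipschitz_q_symbol:
  assumes smooth: "smooth_on_torus V" and pos: "\<And>x. V x > 0"
  obtains L where
    "L-lipschitz_on UNIV (\<lambda>z. hamiltonian_vf (q_symbol V) (torus_of (fst z), snd z))"
proof -
  define W where "W p = V (torus_of p)" for p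
  define W' where "W' p = (partial_x1 V (torus_of p), partial_x2 V (torus_of p))" for p
  define q where "q z = q_symbol V (torus_of (fst z), snd z)" for z
  have W2: "Ck_fun (Suc (Suc 0)) W"
    using smooth unfolding smooth_on_torus_def W_def by blast
  then have diff: "W differentiable (at p)" for p
    by (rule Ck_fun_Suc_differentiable)
  \<comment> \<open>\<open>Ck_fun (Suc (Suc 0))\<close> says that the first partial derivatives are
    differentiable; their continuity has to be deduced from this.\<close>
  have W: "Ck_fun (Suc 0) W"
    unfolding Ck_fun.simps
  proof safe
    show "W differentiable (at p)" for p by (rule diff)
    show "continuous_on UNIV (\<lambda>p. frechet_derivative W (at p) e)" if "e \<in> Basis" for e
      by (rule Ck_fun_Suc_continuous[of 0]) (use W2 that in auto)
  qed
  have part: "torus_deriv e V (torus_of p) = frechet_derivative W (at p) e" for e p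
    by (rule torus_deriv_eq) (use diff[of p] in \<open>simp add: W_def[symmetric] frechet_derivative_works[symmetric]\<close>)
  have partC1: "Ck_fun (Suc 0) (\<lambda>p. torus_deriv e V (torus_of p))" if "e \<in> Basis" for e
    using W2 that unfolding part by simp

  obtain L where L: "L-lipschitz_on UNIV W"
    using periodic_C1_lipschitz[OF W] unfolding W_def by metis
  obtain M1 where "M1-lipschitz_on UNIV (\<lambda>p. partial_x1 V (torus_of p))"
    by (rule periodic_C1_lipschitz[OF partC1[of "(1, 0)"]]) (auto simp: Basis_prod_def)
  moreover obtain M2 where "M2-lipschitz_on UNIV (\<lambda>p. partial_x2 V (torus_of p))"
    by (rule periodic_C1_lipschitz[OF partC1[of "(0, 1)"]]) (auto simp: Basis_prod_def)
  ultimately obtain M where M: "M-lipschitz_on UNIV W'"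
    unfolding W'_def using lipschitz_on_Pair by blast

  have "compact (range W)"
    by (rule compact_range_periodic[OF Ck_fun_Suc_continuous[OF W]]) (simp add: W_def)
  then obtain p where p: "\<And>p'. W p \<le> W p'"
    using compact_attains_inf[of "range W"] by auto
  define m where "m = W p"
  have m: "m > 0" "\<And>p. m \<le> W p"
    using p pos by (auto simp: m_def W_def)
  have "compact (range W')"
    by (rule compact_range_periodic[OF lipschitz_on_continuous_on[OF M]]) (simp add: W'_def)
  then obtain B where B: "\<And>p. norm (W' p) \<le> B"
    using compact_imp_bounded[of "range W'"] unfolding bounded_iff by auto
  have "B \<ge> 0" using norm_ge_zero B order_trans by blast

  have fst: "1-lipschitz_on UNIV (fst :: (real \<times> real) \<times> (real \<times> real) \<Rightarrow> _)"
    and snd: "1-lipschitz_on UNIV (snd :: (real \<times> real) \<times> (real \<times> real) \<Rightarrow> _)"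
    by (intro lipschitz_onI; simp add: dist_fst_le dist_snd_le del: split_paired_All)+

  \<comment> \<open>As the norm of a Lipschitz map, \<open>q\<close> inherits its Lipschitz constant
    by the reverse triangle inequality, without a separate look at \<open>\<xi> = 0\<close>.\<close>
  have q_norm: "q z = norm (snd z, sqrt (W (fst z)))" for z
    using m(1) m(2)[of "fst z"] by (simp add: q_def q_symbol_def W_def norm_Pair)
  have "range W \<subseteq> {m..}" using m by auto
  then have "(1 / sqrt m * (L * 1))-lipschitz_on UNIV (\<lambda>z :: (real \<times> real) \<times> (real \<times> real). sqrt (W (fst z)))"
    using m(2) by (intro lipschitz_on_compose2[OF lipschitz_on_compose2[OF fst]]
        lipschitz_on_subset[OF L] lipschitz_on_subset[OF lipschitz_on_sqrt[OF m(1)]]) auto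
  from lipschitz_on_Pair[OF snd this]
  obtain N where N: "N-lipschitz_on UNIV (\<lambda>z :: (real \<times> real) \<times> (real \<times> real). (snd z, sqrt (W (fst z))))"
    by blast
  have q: "N-lipschitz_on UNIV q"
  proof (rule lipschitz_onI)
    show "dist (q x) (q y) \<le> N * dist x y" for x y
      using lipschitz_onD[OF N, of x y] norm_triangle_ineq3 order_trans
      unfolding q_norm dist_real_def dist_norm by blast
  qed (rule lipschitz_on_nonneg[OF N])

  have "(\<bar>-1/2\<bar> * (M * 1))-lipschitz_on UNIV (\<lambda>z :: (real \<times> real) \<times> (real \<times> real). (-1/2) *\<^sub>R W' (fst z))"
    by (intro lipschitz_on_cmult lipschitz_on_compose2[OF fst] lipschitz_on_subset[OF M]) auto
  from lipschitz_on_Pair[OF snd this]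
  obtain K where K: "K-lipschitz_on UNIV
      (\<lambda>z :: (real \<times> real) \<times> (real \<times> real). (snd z, (-1/2) *\<^sub>R W' (fst z)))"
    by blast

  \<comment> \<open>In \<open>1 + B / sqrt m\<close>, the \<open>1\<close> accounts for the
    covector, whose norm is at most \<open>q\<close>, and the second summand for the gradient term,
    since \<open>sqrt m \<le> q\<close>.\<close>
  have "((K + (1 + B / sqrt m) * N) / sqrt m)-lipschitz_on UNIV
      (\<lambda>z. inverse (q z) *\<^sub>R (snd z, (-1/2) *\<^sub>R W' (fst z)))"
  proof (rule lipschitz_on_inverse_scaleR[OF K q])
    show qm: "sqrt m \<le> q z" for z
      using m(1) m(2)[of "fst z"] norm_snd_le[of "sqrt (W (fst z))" "snd z"]
      unfolding q_norm by (smt (verit) real_norm_def real_sqrt_ge_0_iff real_sqrt_le_mono)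
    fix z :: "(real \<times> real) \<times> (real \<times> real)"
    have "norm (snd z, (-1/2) *\<^sub>R W' (fst z)) \<le> norm (snd z) + norm ((-1/2) *\<^sub>R W' (fst z))"
      by (rule norm_Pair_le)
    also have "norm ((-1/2) *\<^sub>R W' (fst z)) \<le> B"
      using B[of "fst z"] \<open>B \<ge> 0\<close> by simp
    also have "norm (snd z) \<le> q z"
      unfolding q_norm by (rule norm_fst_le)
    also have "B = B / sqrt m * sqrt m" using m by simp
    also have "\<dots> \<le> B / sqrt m * q z"
      using m \<open>B \<ge> 0\<close> by (intro mult_left_mono qm) auto
    finally show "norm (snd z, (-1/2) *\<^sub>R W' (fst z)) \<le> (1 + B / sqrt m) * q z"
      by (simp add: algebra_simps)
  qed (use m \<open>B \<ge> 0\<close> in auto)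
  moreover have "hamiltonian_vf (q_symbol V) (torus_of (fst z), snd z)
      = inverse (q z) *\<^sub>R (snd z, (-1/2) *\<^sub>R W' (fst z))" for z
    unfolding q_def W'_def
    by (rule hamiltonian_vf_q_symbol[OF pos diff[unfolded W_def]])
  ultimately show thesis
    using that by simp
qed

text \<open>Identifies the flow with an honest solution on a short forward interval, which is all
  that the avoidance argument uses.\<close>

lemma q_symbol_flow:
  assumes smooth: "smooth_on_torus V" and pos: "\<And>x. V x > 0"
  obtains Z e where "e > 0" "(torus_of (fst (Z 0)), snd (Z 0)) = \<rho>"
    "\<And>t. t \<in> {0..<e} \<Longrightarrow>
      (Z has_vector_derivative hamiltonian_vf (q_symbol V) (torus_of (fst (Z t)), snd (Z t))) (at t)"
    "\<And>t. t \<in> {0..<e} \<Longrightarrow> hamiltonian_flow UNIV (q_symbol V) t \<rho> = (torus_of (fst (Z t)), snd (Z t))"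
proof -
  let ?F = "\<lambda>z. hamiltonian_vf (q_symbol V) (torus_of (fst z), snd z)"
  obtain L where L: "L-lipschitz_on UNIV ?F"
    using lipschitz_q_symbol[OF assms] .
  obtain p where p: "torus_of p = fst \<rho>"
    using surj_torus_of by blast
  obtain Z e where e: "e > 0" and Z0: "Z 0 = (p, snd \<rho>)"
    and Z: "\<And>t. t \<in> {-e<..<e} \<Longrightarrow> (Z has_vector_derivative ?F (Z t)) (at t)"
    using lipschitz_ode_local_solution[OF L] by metis
  show thesis
  proof (rule that[OF e])
    show \<rho>: "(torus_of (fst (Z 0)), snd (Z 0)) = \<rho>"
      by (simp add: Z0 p)
    fix t assume t: "t \<in> {0..<e}"
    then show "(Z has_vector_derivative ?F (Z t)) (at t)"
      by (intro Z) auto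
    have "hamiltonian_flow UNIV (q_symbol V) t (torus_of (fst (Z 0)), snd (Z 0))
        = (torus_of (fst (Z t)), snd (Z t))"
    proof (rule hamiltonian_flow_eqI[where I = "{-e<..<e}"])
      fix J Y
      assume J: "is_interval J" "0 \<in> J" "t \<in> J" and Y0: "Y 0 = Z 0"
        and Y: "\<And>s. s \<in> J \<Longrightarrow> (torus_of (fst (Y s)), snd (Y s)) \<in> UNIV \<and>
          (Y has_vector_derivative ?F (Y s)) (at s)"
      \<comment> \<open>A competing curve may live on another interval \<open>J\<close>, but that
        interval contains \<open>{0..t}\<close>, where forward uniqueness applies.\<close>
      have "s \<in> J" if "s \<in> {0..t}" for s
        using mem_is_interval_1_I[OF J] that by auto
      then show "Y t = Z t"
        using t Y Y0 by (intro lipschitz_ode_unique[OF L, where Y = Y and Z = Z and t = t] Z) auto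
    qed (use t e Z in \<open>auto simp: is_interval_oo\<close>)
    then show "hamiltonian_flow UNIV (q_symbol V) t \<rho> = (torus_of (fst (Z t)), snd (Z t))"
      by (simp only: \<rho>)
  qed
qed

section \<open>The control condition for the flow of \<open>q\<close>\<close>

text \<open>By continuity nearby values differ by less than \<open>1\<close>; being congruent modulo
  the integers, they agree, so \<open>x\<close> is locally constant.\<close>

lemma deriv_zero_of_circle_of_constant:
  assumes t: "t \<in> {a<..<b}" and c: "\<And>s. s \<in> {a<..<b} \<Longrightarrow> circle_of (x s) = c"
    and x: "(x has_real_derivative d) (at t)"
  shows "d = 0"
proof -
  have "eventually (\<lambda>s. dist (x s) (x t) < 1) (at t)"
    using DERIV_isCont[OF x] unfolding isCont_def by (auto intro: tendstoD)
  moreover have "eventually (\<lambda>s. s \<in> {a<..<b}) (at t)"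
    using t by (intro eventually_at_in_open') auto
  ultimately have "eventually (\<lambda>s. x s = x t) (at t)"
  proof eventually_elim
    case (elim s)
    have "circle_of (x s) = circle_of (x t)" using c elim t by simp
    then have "x s - x t \<in> \<int>" by transfer
    then show ?case using elim Ints_nonzero_abs_less1[of "x s - x t"]
      by (simp add: dist_real_def)
  qed
  then have "eventually (\<lambda>s. x s = x t) (nhds t)"
    by (simp add: eventually_nhds_conv_at)
  then have "(x has_real_derivative 0) (at t)"
    by (subst DERIV_cong_ev[OF refl _ refl]) auto
  then show ?thesis using DERIV_unique[OF x] by blast
qed

lemma GCC_V_complement_of_circle:
  assumes smooth: "smooth_on_torus V" and pos: "\<And>x. V x > 0"
    and neg: "\<And>x2. partial_x1 V (c, x2) < 0" and T: "T > 0"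
  shows "GCC_V V {(x1, x2). x1 \<noteq> c} T"
  unfolding GCC_V_def
proof (rule allI, rule ccontr)
  fix \<rho>
  assume notin: "\<not> (\<exists>t\<in>{0<..<T}. fst (hamiltonian_flow UNIV (q_symbol V) t \<rho>) \<in> {(x1, x2). x1 \<noteq> c})"
  let ?F = "\<lambda>z. hamiltonian_vf (q_symbol V) (torus_of (fst z), snd z)"
  obtain Z e where e: "e > 0"
    and Z: "\<And>t. t \<in> {0..<e} \<Longrightarrow> (Z has_vector_derivative ?F (Z t)) (at t)"
    and flow: "\<And>t. t \<in> {0..<e} \<Longrightarrow> hamiltonian_flow UNIV (q_symbol V) t \<rho> = (torus_of (fst (Z t)), snd (Z t))"
    using q_symbol_flow[OF smooth pos] by metis
  \<comment> \<open>Below \<open>e\<close> the flow is given by \<open>Z\<close>, and below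
    \<open>T\<close> it is assumed to miss the open set.\<close>
  define \<delta> where "\<delta> = min e T"
  have \<delta>: "\<delta> > 0" "\<delta> \<le> e" "\<delta> \<le> T" using e T by (auto simp: \<delta>_def)
  define q where "q t = q_symbol V (torus_of (fst (Z t)), snd (Z t))" for t
  have q: "q t > 0" for t
    unfolding q_def q_symbol_def by (simp add: add_nonneg_pos pos)
  have x1: "circle_of (fst (fst (Z t))) = c" if "t \<in> {0<..<\<delta>}" for t
  proof -
    have "fst (fst (hamiltonian_flow UNIV (q_symbol V) t \<rho>)) = c"
      using notin that \<delta> by (auto simp: split_beta)
    then show ?thesis
      using flow[of t] that \<delta> by (simp add: torus_of_def split_beta)
  qed
  have F: "?F (Z t) = inverse (q t) *\<^sub>R (snd (Z t), (-1/2) *\<^sub>R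
      (partial_x1 V (torus_of (fst (Z t))), partial_x2 V (torus_of (fst (Z t)))))" for t
    unfolding q_def
  proof (rule hamiltonian_vf_q_symbol[OF pos])
    have "Ck_fun (Suc 0) (\<lambda>p. V (torus_of p))"
      using smooth unfolding smooth_on_torus_def by blast
    then show "(\<lambda>p. V (torus_of p)) differentiable (at (fst (Z t)))"
      by (rule Ck_fun_Suc_differentiable)
  qed
  have Zt: "(Z has_vector_derivative ?F (Z t)) (at t)" if "t \<in> {0<..<\<delta>}" for t
    using that \<delta> by (intro Z) auto
  \<comment> \<open>The lifted first coordinate has velocity \<open>\<xi>\<^sub>1 / q\<close> and is
    constant modulo the integers.\<close>
  have \<xi>1: "fst (snd (Z t)) = 0" if t: "t \<in> {0<..<\<delta>}" for t
  proof -
    have "((\<lambda>s. fst (fst (Z s))) has_real_derivative fst (fst (?F (Z t)))) (at t)"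
      unfolding has_real_derivative_iff_has_vector_derivative
      by (intro bounded_linear.has_vector_derivative[OF bounded_linear_fst] Zt t)
    from deriv_zero_of_circle_of_constant[OF t x1 this]
    show ?thesis using q[of t] by (simp add: F)
  qed
  define t where "t = \<delta> / 2"
  have t: "t \<in> {0<..<\<delta>}" using \<delta> by (simp add: t_def)
  have \<xi>1': "((\<lambda>s. fst (snd (Z s))) has_real_derivative fst (snd (?F (Z t)))) (at t)"
    unfolding has_real_derivative_iff_has_vector_derivative
    by (intro bounded_linear.has_vector_derivative[OF bounded_linear_fst]
        bounded_linear.has_vector_derivative[OF bounded_linear_snd] Zt t)
  \<comment> \<open>The same lemma serves for the real-valued \<open>\<xi>\<^sub>1\<close>, which
    vanishes on the interval and so has constant image \<open>circle_of 0\<close>.\<close>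
  have "fst (snd (?F (Z t))) = 0"
    by (rule deriv_zero_of_circle_of_constant[OF t _ \<xi>1', of "circle_of 0"]) (simp add: \<xi>1)
  then have "partial_x1 V (torus_of (fst (Z t))) = 0"
    using q[of t] by (simp add: F)
  moreover have "torus_of (fst (Z t)) = (c, snd (torus_of (fst (Z t))))"
    using x1[OF t] by (simp add: torus_of_def split_beta)
  ultimately show False using neg by (metis less_irrefl)
qed

section \<open>Failure of the geometric control condition\<close>

lemma hamiltonian_vf_covector_norm:
  "hamiltonian_vf covector_norm (x, (0, 1)) = ((0, 1), 0)"
proof -
  have "((\<lambda>s. covector_norm (x, (s, 1))) has_real_derivative 0) (at 0)"
    unfolding covector_norm_def by (auto simp: norm_Pair intro!: derivative_eq_intros)
  moreover have "((\<lambda>s. covector_norm (x, (0, s))) has_real_derivative 1) (at 1)"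
    \<comment> \<open>\<open>norm (0, s)\<close> is the absolute value of \<open>s\<close>, which
      agrees with \<open>s\<close> on the positive half-line around \<open>1\<close>.\<close>
    by (rule has_field_derivative_transform_within_open[where S = "{0<..}" and f = "\<lambda>s. s"])
      (auto simp: covector_norm_def)
  ultimately show ?thesis
    unfolding hamiltonian_vf_def
    by (simp add: DERIV_imp_deriv covector_norm_def torus_deriv_def zero_prod_def)
qed

text \<open>The Euclidean norm does not depend on the base point, so every integral curve conserves
  its covector.\<close>

lemma snd_hamiltonian_vf_covector_norm:
  "snd (hamiltonian_vf covector_norm (x, \<xi>)) = 0"
  by (cases \<xi>) (simp add: hamiltonian_vf_def covector_norm_def torus_deriv_def zero_prod_def)

text \<open>The field \<open>\<xi> / norm \<xi>\<close> has no Lipschitz bound near the zero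
  section. Uniqueness comes instead from conservation of the covector: it stays
  \<open>(0, 1)\<close>, so any competitor has the same constant velocity as
  \<open>Z\<close>.\<close>

lemma vertical_geodesic_flow:
  "hamiltonian_flow punctured_cotangent covector_norm t (torus_of (a, 0), (0, 1))
    = (torus_of (a, t), (0, 1))"
proof -
  define Z :: "real \<Rightarrow> (real \<times> real) \<times> (real \<times> real)" where "Z s = ((a, s), (0, 1))" for s
  have Z: "(Z has_vector_derivative ((0, 1), 0)) (at s)" for s
    unfolding Z_def zero_prod_def
    by (intro has_vector_derivative_Pair has_vector_derivative_const has_vector_derivative_id[unfolded id_def])
  have "hamiltonian_flow punctured_cotangent covector_norm t (torus_of (fst (Z 0)), snd (Z 0))
      = (torus_of (fst (Z t)), snd (Z t))"
  proof (rule hamiltonian_flow_eqI[where I = UNIV])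
    show "(torus_of (fst (Z s)), snd (Z s)) \<in> punctured_cotangent \<and>
        (Z has_vector_derivative hamiltonian_vf covector_norm (torus_of (fst (Z s)), snd (Z s))) (at s)" for s
      using Z by (simp add: Z_def hamiltonian_vf_covector_norm punctured_cotangent_def zero_prod_def)
    fix J Y
    assume J: "is_interval J" "0 \<in> J" "t \<in> J" and Y0: "Y 0 = Z 0"
      and Y: "\<And>s. s \<in> J \<Longrightarrow> (torus_of (fst (Y s)), snd (Y s)) \<in> punctured_cotangent \<and>
        (Y has_vector_derivative hamiltonian_vf covector_norm (torus_of (fst (Y s)), snd (Y s))) (at s)"
    have convex: "convex J" using J(1) by (rule is_interval_convex)
    have "((\<lambda>s. snd (Y s)) has_vector_derivative 0) (at s within J)" if "s \<in> J" for s
      using bounded_linear.has_vector_derivative[OF bounded_linear_snd conjunct2[OF Y[OF that]]]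
      by (simp add: snd_hamiltonian_vf_covector_norm has_vector_derivative_at_within)
    then obtain \<xi> where "\<And>s. s \<in> J \<Longrightarrow> snd (Y s) = \<xi>"
      using has_vector_derivative_zero_constant[OF convex] by blast
    then have \<xi>: "snd (Y s) = (0, 1)" if "s \<in> J" for s
      using that J(2) Y0 by (metis Z_def snd_conv)
    have "((\<lambda>s. Y s - Z s) has_vector_derivative 0) (at s within J)" if "s \<in> J" for s
      using has_vector_derivative_diff[OF conjunct2[OF Y[OF that]] Z]
      by (simp add: \<xi>[OF that] hamiltonian_vf_covector_norm has_vector_derivative_at_within)
    then obtain d where "\<And>s. s \<in> J \<Longrightarrow> Y s - Z s = d"
      using has_vector_derivative_zero_constant[OF convex] by blast
    from this[OF J(2)] this[OF J(3)] show "Y t = Z t"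
      by (simp add: Y0)
  qed auto
  then show ?thesis by (simp add: Z_def)
qed

text \<open>One unit covector tangent to the circle \<open>x1 = c\<close> refutes the condition for
  every \<open>T\<close>, as its geodesic remains in that circle for all times.\<close>

lemma not_GCC_complement_of_circle:
  "\<not> GCC {(x1, x2). x1 \<noteq> c} T"
proof
  assume gcc: "GCC {(x1, x2). x1 \<noteq> c} T"
  obtain p where "torus_of p = (c, 0)" using surj_torus_of by blast
  then have c: "circle_of (fst p) = c" by (simp add: torus_of_def split_beta)
  have "(torus_of (fst p, 0), (0, 1)) \<in> cosphere"
    by (simp add: cosphere_def)
  from bspec[OF gcc[unfolded GCC_def] this]
  obtain t where "fst (hamiltonian_flow punctured_cotangent covector_norm t
      (torus_of (fst p, 0), (0, 1))) \<in> {(x1, x2). x1 \<noteq> c}"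
    by (elim bexE)
  then show False
    unfolding vertical_geodesic_flow by (simp add: torus_of_def c)
qed

theorem lemma1p9:
  fixes V :: "torus \<Rightarrow> real" and c :: circle and \<omega> :: "torus set" and T :: real
  assumes "smooth_on_torus V"
    and "\<And>x. V x > 0"
    and "Linf_norm V = 1"
    and "\<And>x2. partial_x1 V (c, x2) < 0"
    and "\<omega> = {(x1, x2). x1 \<noteq> c}"
    and "T > 0"
  shows "GCC_V V \<omega> T \<and> \<not> GCC \<omega> T"
  using assms GCC_V_complement_of_circle not_GCC_complement_of_circle by simp

end
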